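(* Let $H$ be a nonzero separable real or complex Hilbert space and let $A, B$ be positive bounded linear operators on $H$. Then $A \perp_I B$ if and only if there exists a sequence $\{x_n\}$ of unit vectors of $H$ such that $\lim_{n\to\infty} \|M(A,B) x_n\| = \|A + B\|$ and the limit $\lim_{n \to \infty} \mathrm{Re} \langle BA x_n, x_n \rangle$ exists and is $\le 0$.
   Context: An operator $A$ on $H$ is positive if it is bounded, self-adjoint and $\langle Ax, x\rangle \ge 0$ for all $x \in H$. Norms of operators are operator norms. For positive operators $A, B$ isosceles orthogonality $A \perp_I B$ means $\|A + B\| = \|A - B\|$ (the real version of the notion is used for positive operators, whatever the scalar field). For operators $A,B$, define $M(A,B) = A$ if $\|B\| \le \|A\|$, and $M(A,B) = B$ if $\|A\| < \|B\|$. *)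

theory Defs
  imports "HOL-Analysis.Analysis"
begin

(* Complex inner product spaces.  The metric and topology are those of the underlying
   real inner product space, whose inner product is the real part of the complex one;
   positive definiteness of cinner and norm x = sqrt (Re (cinner x x)) are therefore
   inherited from real_inner.  cinner is linear in its first argument. *)
class complex_inner = real_inner +
  fixes scaleC :: "complex \<Rightarrow> 'a \<Rightarrow> 'a"
    and cinner :: "'a \<Rightarrow> 'a \<Rightarrow> complex"
  assumes scaleC_add_right: "scaleC c (x + y) = scaleC c x + scaleC c y"
    and scaleC_add_left: "scaleC (c + d) x = scaleC c x + scaleC d x"
    and scaleC_scaleC: "scaleC c (scaleC d x) = scaleC (c * d) x"
    and scaleC_one: "scaleC 1 x = x"
    and scaleR_scaleC: "scaleR r x = scaleC (complex_of_real r) x"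
    and cinner_commute: "cinner x y = cnj (cinner y x)"
    and cinner_add_left: "cinner (x + y) z = cinner x z + cinner y z"
    and cinner_scaleC_left: "cinner (scaleC c x) y = c * cinner x y"
    and inner_eq_Re_cinner: "inner x y = Re (cinner x y)"

instantiation complex :: complex_inner
begin

definition "scaleC_complex (c::complex) (x::complex) = c * x"
definition "cinner_complex (x::complex) y = x * cnj y"

instance
  by standard
    (auto simp: scaleC_complex_def cinner_complex_def algebra_simps scaleR_conv_of_real
      inner_complex_def)

end

definition positive_op :: "('a::real_inner \<Rightarrow>\<^sub>L 'a) \<Rightarrow> bool" where
  "positive_op A \<longleftrightarrow>
     (\<forall>x y. inner (blinfun_apply A x) y = inner x (blinfun_apply A y)) \<and>
     (\<forall>x. 0 \<le> inner (blinfun_apply A x) x)"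

(* A bounded complex-linear operator is a bounded real-linear one that commutes with
   complex scalars; the operator norm does not depend on the choice of scalars. *)
definition complex_linear_op :: "('a::complex_inner \<Rightarrow>\<^sub>L 'a) \<Rightarrow> bool" where
  "complex_linear_op A \<longleftrightarrow>
     (\<forall>c x. blinfun_apply A (scaleC c x) = scaleC c (blinfun_apply A x))"

definition complex_positive_op :: "('a::complex_inner \<Rightarrow>\<^sub>L 'a) \<Rightarrow> bool" where
  "complex_positive_op A \<longleftrightarrow>
     complex_linear_op A \<and>
     (\<forall>x y. cinner (blinfun_apply A x) y = cinner x (blinfun_apply A y)) \<and>
     (\<forall>x. cinner (blinfun_apply A x) x \<in> \<real>\<^sub>\<ge>\<^sub>0)"

definition isosceles_orthogonal :: "'a::real_normed_vector \<Rightarrow> 'a \<Rightarrow> bool" where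
  "isosceles_orthogonal A B \<longleftrightarrow> norm (A + B) = norm (A - B)"

definition max_norm_op :: "'a::real_normed_vector \<Rightarrow> 'a \<Rightarrow> 'a" where
  "max_norm_op A B = (if norm B \<le> norm A then A else B)"

end

theory Submission
  imports Defs
begin

text \<open>
  Let A have the larger norm. Comparing quadratic forms gives
  norm (A - B) \<le> norm A \<le> norm (A + B), so isosceles orthogonality forces
  norm A = norm (A + B); unit vectors on which the form of A tends to norm A then make the form
  of B, hence B itself, tend to 0. Conversely, expanding the square of norm ((A - B) x) along the
  given sequence shows that norm (A - B) is at least norm (A + B).
\<close>

text \<open>Polarization writes \<open>inner (T x) y\<close> as a difference of two values of the
  quadratic form, so a bound on the form becomes a bound on the operator norm. All later norm
  comparisons are made through forms in this way.\<close>

lemma norm_selfadjoint_le: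
  fixes T :: "'a::real_inner \<Rightarrow>\<^sub>L 'a"
  assumes sym: "\<And>x y. inner (T x) y = inner x (T y)"
    and bound: "\<And>x. \<bar>inner (T x) x\<bar> \<le> c * (norm x)\<^sup>2"
    and "0 \<le> c"
  shows "norm T \<le> c"
proof (rule norm_blinfun_bound)
  show "0 \<le> c" by fact
next
  fix x
  show "norm (T x) \<le> c * norm x"
  proof (cases "T x = 0")
    case True
    then show ?thesis using \<open>0 \<le> c\<close> by simp
  next
    case False
    then have "x \<noteq> 0" by (auto simp: blinfun.zero_right)
    \<comment> \<open>The direction of \<open>T x\<close> gives equality in Cauchy-Schwarz; the
      length of \<open>x\<close> makes the parallelogram sum a multiple of
      \<open>(norm x)\<^sup>2\<close> alone.\<close>
    define y where "y = (norm x / norm (T x)) *\<^sub>R T x"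
    have ny: "norm y = norm x" using False by (simp add: y_def)
    have Txy: "inner (T x) y = norm x * norm (T x)"
      using False by (simp add: y_def dot_square_norm power2_eq_square)
    \<comment> \<open>polarization and the parallelogram law\<close>
    have "4 * inner (T x) y = inner (T (x + y)) (x + y) - inner (T (x - y)) (x - y)"
      using sym[of y x] by (simp add: blinfun.bilinear_simps algebra_simps inner_commute)
    also have "\<dots> \<le> c * (norm (x + y))\<^sup>2 + c * (norm (x - y))\<^sup>2"
      using bound[of "x + y"] bound[of "x - y"] by linarith
    also have "\<dots> = 4 * (c * (norm x)\<^sup>2)"
    proof -
      have "(norm (x + y))\<^sup>2 + (norm (x - y))\<^sup>2 = 4 * (norm x)\<^sup>2"
        using arg_cong[OF ny, of "\<lambda>r. r\<^sup>2"]
        by (simp add: power2_norm_eq_inner algebra_simps inner_commute)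
      then show ?thesis by (simp flip: distrib_left)
    qed
    finally have "norm x * norm (T x) \<le> norm x * (c * norm x)"
      by (simp add: Txy power2_eq_square algebra_simps)
    then show ?thesis using \<open>x \<noteq> 0\<close> by simp
  qed
qed

lemma inner_blinfun_le: "inner (T x) x \<le> norm T * (norm x)\<^sup>2"
  for T :: "'a::real_inner \<Rightarrow>\<^sub>L 'a"
proof -
  have "inner (T x) x \<le> norm (T x) * norm x" by (rule norm_cauchy_schwarz)
  also have "\<dots> \<le> norm T * norm x * norm x"
    by (intro mult_right_mono norm_blinfun) auto
  finally show ?thesis by (simp add: power2_eq_square algebra_simps)
qed

lemma positive_op_selfadjoint: "positive_op A \<Longrightarrow> inner (A x) y = inner x (A y)"
  by (simp add: positive_op_def)

lemma positive_op_nonneg: "positive_op A \<Longrightarrow> 0 \<le> inner (A x) x"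
  unfolding positive_op_def by blast

text \<open>Positivity is tested at the vector \<open>A x - norm A *\<^sub>R x\<close>. The
  inequality converts smallness of the form at \<open>x\<close> into smallness of the vector
  \<open>A x\<close>.\<close>

lemma positive_op_norm_power2_le:
  fixes A :: "'a::real_inner \<Rightarrow>\<^sub>L 'a"
  assumes "positive_op A"
  shows "(norm (A x))\<^sup>2 \<le> norm A * inner (A x) x"
proof (cases "norm A = 0")
  case False
  define c where "c = norm A"
  have "c > 0" using False by (simp add: c_def)
  have "0 \<le> inner (A (A x - c *\<^sub>R x)) (A x - c *\<^sub>R x)"
    using assms by (rule positive_op_nonneg)
  also have "\<dots> = inner (A (A x)) (A x) - 2 * c * (norm (A x))\<^sup>2 + c\<^sup>2 * inner (A x) x"
  proof -
    have "inner (A (A x)) x = inner (A x) (A x)"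
      using assms by (rule positive_op_selfadjoint)
    then show ?thesis
      by (simp add: blinfun.bilinear_simps inner_diff_left inner_diff_right
          power2_norm_eq_inner power2_eq_square[of c] algebra_simps)
  qed
  \<comment> \<open>The form at \<open>A x\<close> is at most
    \<open>c * (norm (A x))\<^sup>2\<close>, which cancels one of the two negative copies.\<close>
  also have "\<dots> \<le> c * (norm (A x))\<^sup>2 - 2 * c * (norm (A x))\<^sup>2 + c\<^sup>2 * inner (A x) x"
    using inner_blinfun_le[of A "A x"] by (simp add: c_def)
  finally have "c * (norm (A x))\<^sup>2 \<le> c * (c * inner (A x) x)"
    by (simp add: power2_eq_square algebra_simps)
  then show ?thesis using \<open>c > 0\<close> unfolding c_def by simp
qed auto

text \<open>If the form stayed at or below \<open>norm A - e\<close> on all unit vectors,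
  \<open>norm_selfadjoint_le\<close> would give \<open>norm A \<le> norm A - e\<close>. The vector
  \<open>v\<close> guarantees that unit vectors exist.\<close>

lemma positive_op_norming_sequence:
  fixes A :: "'a::real_inner \<Rightarrow>\<^sub>L 'a"
  assumes pos: "positive_op A" and "v \<noteq> (0::'a)"
  obtains x :: "nat \<Rightarrow> 'a"
    where "\<And>n. norm (x n) = 1" "(\<lambda>n. inner (A (x n)) (x n)) \<longlonglongrightarrow> norm A"
proof -
  have ex: "\<exists>x. norm x = 1 \<and> norm A - e < inner (A x) x" if "e > 0" for e
  proof (rule ccontr)
    assume "\<nexists>x. norm x = 1 \<and> norm A - e < inner (A x) x"
    then have unit: "inner (A x) x \<le> norm A - e" if "norm x = 1" for x
      using that by (meson not_less)
    have nonneg: "0 \<le> inner (A x) x" for x using pos by (rule positive_op_nonneg)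
    \<comment> \<open>The bound in \<open>norm_selfadjoint_le\<close> must be nonnegative; the unit
      vector \<open>sgn v\<close> shows this, its form value lying between 0 and
      \<open>norm A - e\<close>.\<close>
    have "0 \<le> norm A - e"
      using unit[of "sgn v"] nonneg[of "sgn v"] \<open>v \<noteq> 0\<close> by (simp add: norm_sgn)
    moreover have "inner (A x) x \<le> (norm A - e) * (norm x)\<^sup>2" for x
    proof (cases "x = 0")
      case False
      have "inner (A x) x = (norm x)\<^sup>2 * inner (A (sgn x)) (sgn x)"
        using False by (simp add: sgn_div_norm blinfun.bilinear_simps power2_eq_square field_simps)
      then show ?thesis
        using unit[of "sgn x"] False by (simp add: norm_sgn mult.commute mult_right_mono)
    qed simp
    ultimately have "norm A \<le> norm A - e"
      using pos nonneg by (intro norm_selfadjoint_le) (auto simp: positive_op_def)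
    then show False using \<open>e > 0\<close> by simp
  qed
  have "\<forall>n. \<exists>x. norm x = 1 \<and> norm A - 1 / real (Suc n) < inner (A x) x"
    using ex by (simp del: of_nat_Suc)
  then obtain x where x: "\<And>n. norm (x n) = 1"
    "\<And>n. norm A - 1 / real (Suc n) < inner (A (x n)) (x n)"
    by metis
  have "(\<lambda>n. inner (A (x n)) (x n)) \<longlonglongrightarrow> norm A"
  proof (rule real_tendsto_sandwich)
    show "\<forall>\<^sub>F n in sequentially. norm A - 1 / real (Suc n) \<le> inner (A (x n)) (x n)"
      using x(2) by (intro always_eventually allI less_imp_le)
    show "\<forall>\<^sub>F n in sequentially. inner (A (x n)) (x n) \<le> norm A"
      using inner_blinfun_le[of A] x(1) by (intro always_eventually allI) (metis mult.right_neutral power_one)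
    show "(\<lambda>n. norm A - 1 / real (Suc n)) \<longlonglongrightarrow> norm A"
      using tendsto_diff[OF tendsto_const LIMSEQ_inverse_real_of_nat, of "norm A"]
      by (simp add: inverse_eq_divide)
  qed auto
  with x(1) show thesis by (rule that)
qed

text \<open>Adding \<open>B\<close> can only raise the quadratic form of \<open>A\<close>.\<close>

lemma norm_le_norm_add_positive_op:
  fixes A B :: "'a::real_inner \<Rightarrow>\<^sub>L 'a"
  assumes "positive_op A" "positive_op B"
  shows "norm A \<le> norm (A + B)"
proof (rule norm_selfadjoint_le)
  fix x
  have "inner (A x) x \<le> inner ((A + B) x) x"
    using positive_op_nonneg[OF assms(2), of x]
    by (simp add: blinfun.bilinear_simps inner_add_left)
  also have "\<dots> \<le> norm (A + B) * (norm x)\<^sup>2" by (rule inner_blinfun_le)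
  finally show "\<bar>inner (A x) x\<bar> \<le> norm (A + B) * (norm x)\<^sup>2"
    using positive_op_nonneg[OF assms(1), of x] by simp
qed (use assms in \<open>auto simp: positive_op_def\<close>)

text \<open>On unit vectors both forms take values between 0 and \<open>norm A\<close>, so their
  difference is at most \<open>norm A\<close> in absolute value.\<close>

lemma norm_diff_positive_op_le:
  fixes A B :: "'a::real_inner \<Rightarrow>\<^sub>L 'a"
  assumes "positive_op A" "positive_op B" "norm B \<le> norm A"
  shows "norm (A - B) \<le> norm A"
proof (rule norm_selfadjoint_le)
  fix x
  have "inner (B x) x \<le> norm A * (norm x)\<^sup>2"
    using inner_blinfun_le[of B x] mult_right_mono[OF assms(3), of "(norm x)\<^sup>2"] by simp
  moreover have "0 \<le> inner (A x) x" "0 \<le> inner (B x) x"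
    using assms by (auto intro: positive_op_nonneg)
  ultimately show "\<bar>inner ((A - B) x) x\<bar> \<le> norm A * (norm x)\<^sup>2"
    using inner_blinfun_le[of A x] by (simp add: blinfun.bilinear_simps inner_diff_left)
qed (use assms in \<open>auto simp: positive_op_def blinfun.bilinear_simps inner_diff_left inner_diff_right\<close>)

lemma isosceles_orthogonal_commute:
  "isosceles_orthogonal A B \<longleftrightarrow> isosceles_orthogonal B A"
  by (simp add: isosceles_orthogonal_def add.commute norm_minus_commute)

text \<open>The case in which \<open>A\<close> is the operator of larger norm. The expression
  \<open>inner (A (x n)) (B (x n))\<close> is symmetric in the two operators, so the other case
  follows by exchanging them.\<close>

lemma isosceles_orthogonal_positive_op_ordered:
  fixes A B :: "'a::real_inner \<Rightarrow>\<^sub>L 'a"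
  assumes nz: "v \<noteq> (0::'a)" and pos: "positive_op A" "positive_op B" and le: "norm B \<le> norm A"
  shows "isosceles_orthogonal A B \<longleftrightarrow>
    (\<exists>x. (\<forall>n::nat. norm (x n) = 1) \<and> (\<lambda>n. norm (A (x n))) \<longlonglongrightarrow> norm (A + B) \<and>
      (\<exists>L\<le>0. (\<lambda>n. inner (A (x n)) (B (x n))) \<longlonglongrightarrow> L))"
proof
  assume "isosceles_orthogonal A B"
  then have eq: "norm (A + B) = norm A"
    using norm_diff_positive_op_le[OF pos le] norm_le_norm_add_positive_op[OF pos]
    by (simp add: isosceles_orthogonal_def)
  obtain x where unit: "\<And>n. norm (x n) = 1" and lim: "(\<lambda>n. inner (A (x n)) (x n)) \<longlonglongrightarrow> norm A"
    using positive_op_norming_sequence[OF pos(1) nz] by blast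
  have limA: "(\<lambda>n. norm (A (x n))) \<longlonglongrightarrow> norm A"
  proof (rule real_tendsto_sandwich[OF _ _ lim tendsto_const])
    show "\<forall>\<^sub>F n in sequentially. inner (A (x n)) (x n) \<le> norm (A (x n))"
      using norm_cauchy_schwarz[of "A (x n)" "x n" for n] unit by simp
    show "\<forall>\<^sub>F n in sequentially. norm (A (x n)) \<le> norm A"
      using norm_blinfun[of A "x n" for n] unit by simp
  qed
  \<comment> \<open>Since \<open>norm (A + B)\<close> equals \<open>norm A\<close>, the two forms
    share the budget \<open>norm A\<close>, and the form of \<open>A\<close> uses up all of it in
    the limit.\<close>
  have form_sum: "inner (A (x n)) (x n) + inner (B (x n)) (x n) \<le> norm A" for n
    using inner_blinfun_le[of "A + B" "x n"] unit[of n] eq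
    by (simp add: blinfun.bilinear_simps inner_add_left)
  have "(\<lambda>n. norm A - inner (A (x n)) (x n)) \<longlonglongrightarrow> norm A - norm A"
    by (intro tendsto_intros lim)
  then have lim0: "(\<lambda>n. norm A - inner (A (x n)) (x n)) \<longlonglongrightarrow> 0" by simp
  have formB: "(\<lambda>n. inner (B (x n)) (x n)) \<longlonglongrightarrow> 0"
  proof (rule real_tendsto_sandwich[OF _ _ tendsto_const lim0])
    show "\<forall>\<^sub>F n in sequentially. 0 \<le> inner (B (x n)) (x n)"
      using positive_op_nonneg[OF pos(2)] by simp
    show "\<forall>\<^sub>F n in sequentially. inner (B (x n)) (x n) \<le> norm A - inner (A (x n)) (x n)"
      using form_sum by (intro always_eventually allI) (simp add: algebra_simps)
  qed
  \<comment> \<open>This multiple of the form dominates \<open>(norm (B (x n)))\<^sup>2\<close> by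
    \<open>positive_op_norm_power2_le\<close>, so the vectors \<open>B (x n)\<close> themselves tend
    to 0.\<close>
  have lim0': "(\<lambda>n. norm B * inner (B (x n)) (x n)) \<longlonglongrightarrow> 0"
    using tendsto_mult_left[OF formB, of "norm B"] by simp
  have "(\<lambda>n. (norm (B (x n)))\<^sup>2) \<longlonglongrightarrow> 0"
    by (rule real_tendsto_sandwich[OF _ _ tendsto_const lim0'])
      (use positive_op_norm_power2_le[OF pos(2)] in auto)
  then have "(\<lambda>n. norm (B (x n))) \<longlonglongrightarrow> 0"
    using tendsto_real_sqrt[of "\<lambda>n. (norm (B (x n)))\<^sup>2" 0] by simp
  then have "(\<lambda>n. norm (A (x n)) * norm (B (x n))) \<longlonglongrightarrow> norm A * 0"
    by (intro tendsto_mult limA)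
  \<comment> \<open>Cauchy-Schwarz yields the limit, and \<open>L = 0\<close> is the
    witness.\<close>
  then have "(\<lambda>n. inner (A (x n)) (B (x n))) \<longlonglongrightarrow> 0"
    by (intro Lim_null_comparison[of "\<lambda>n. inner (A (x n)) (B (x n))"
          "\<lambda>n. norm (A (x n)) * norm (B (x n))"])
      (auto simp: Cauchy_Schwarz_ineq2)
  then show "\<exists>x. (\<forall>n::nat. norm (x n) = 1) \<and> (\<lambda>n. norm (A (x n))) \<longlonglongrightarrow> norm (A + B) \<and>
      (\<exists>L\<le>0. (\<lambda>n. inner (A (x n)) (B (x n))) \<longlonglongrightarrow> L)"
    using unit limA eq by auto
next
  assume "\<exists>x. (\<forall>n::nat. norm (x n) = 1) \<and> (\<lambda>n. norm (A (x n))) \<longlonglongrightarrow> norm (A + B) \<and>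
      (\<exists>L\<le>0. (\<lambda>n. inner (A (x n)) (B (x n))) \<longlonglongrightarrow> L)"
  then obtain x L where unit: "\<And>n::nat. norm (x n) = 1"
    and limA: "(\<lambda>n. norm (A (x n))) \<longlonglongrightarrow> norm (A + B)"
    and "L \<le> 0" and limL: "(\<lambda>n. inner (A (x n)) (B (x n))) \<longlonglongrightarrow> L"
    by blast
  \<comment> \<open>The expansion of \<open>(norm ((A - B) (x n)))\<^sup>2\<close> without its last
    term \<open>(norm (B (x n)))\<^sup>2\<close>: convergence of that term is not given, but it is
    nonnegative, and a lower bound is enough.\<close>
  have lim: "(\<lambda>n. (norm (A (x n)))\<^sup>2 - 2 * inner (A (x n)) (B (x n)))
      \<longlonglongrightarrow> (norm (A + B))\<^sup>2 - 2 * L"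
    by (intro tendsto_intros limA limL)
  have ub: "(norm (A (x n)))\<^sup>2 - 2 * inner (A (x n)) (B (x n)) \<le> (norm (A - B))\<^sup>2" for n
  proof -
    have "(norm ((A - B) (x n)))\<^sup>2 =
        (norm (A (x n)))\<^sup>2 - 2 * inner (A (x n)) (B (x n)) + (norm (B (x n)))\<^sup>2"
      by (simp add: blinfun.bilinear_simps power2_norm_eq_inner algebra_simps inner_commute)
    moreover have "(norm ((A - B) (x n)))\<^sup>2 \<le> (norm (A - B))\<^sup>2"
      using norm_blinfun[of "A - B" "x n"] unit[of n] by (intro power_mono) auto
    ultimately show ?thesis using zero_le_power2[of "norm (B (x n))"] by linarith
  qed
  have "(norm (A + B))\<^sup>2 - 2 * L \<le> (norm (A - B))\<^sup>2"
    by (rule LIMSEQ_le_const2[OF lim]) (use ub in blast)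
  then have "(norm (A + B))\<^sup>2 \<le> (norm (A - B))\<^sup>2" using \<open>L \<le> 0\<close> by linarith
  then have "norm (A + B) \<le> norm (A - B)" by (rule power2_le_imp_le) simp
  \<comment> \<open>This closes the chain \<open>norm (A + B)\<close> \<le>
    \<open>norm (A - B)\<close> \<le> \<open>norm A\<close> \<le>
    \<open>norm (A + B)\<close>.\<close>
  then show "isosceles_orthogonal A B"
    using norm_diff_positive_op_le[OF pos le] norm_le_norm_add_positive_op[OF pos]
    by (simp add: isosceles_orthogonal_def)
qed

lemma isosceles_orthogonal_positive_op_iff:
  fixes A B :: "'a::real_inner \<Rightarrow>\<^sub>L 'a"
  assumes nz: "v \<noteq> (0::'a)" and pos: "positive_op A" "positive_op B"
  shows "isosceles_orthogonal A B \<longleftrightarrow>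
    (\<exists>x. (\<forall>n::nat. norm (x n) = 1) \<and> (\<lambda>n. norm (max_norm_op A B (x n))) \<longlonglongrightarrow> norm (A + B) \<and>
      (\<exists>L\<le>0. (\<lambda>n. inner ((B o\<^sub>L A) (x n)) (x n)) \<longlonglongrightarrow> L))"
proof -
  \<comment> \<open>Self-adjointness of \<open>B\<close> brings the form of the product into the
    symmetric shape of the ordered case.\<close>
  have BA: "inner ((B o\<^sub>L A) y) y = inner (A y) (B y)" for y
    using pos(2) by (simp add: positive_op_def)
  show ?thesis
  proof (cases "norm B \<le> norm A")
    case True
    then show ?thesis
      using isosceles_orthogonal_positive_op_ordered[OF nz pos True]
      by (simp add: max_norm_op_def BA del: blinfun_apply_blinfun_compose)
  next
    case False
    then have "norm A \<le> norm B" by simp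
    from isosceles_orthogonal_positive_op_ordered[OF nz pos(2) pos(1) this]
    have "isosceles_orthogonal A B \<longleftrightarrow>
      (\<exists>x. (\<forall>n::nat. norm (x n) = 1) \<and> (\<lambda>n. norm (B (x n))) \<longlonglongrightarrow> norm (A + B) \<and>
        (\<exists>L\<le>0. (\<lambda>n. inner (A (x n)) (B (x n))) \<longlonglongrightarrow> L))"
      by (simp add: isosceles_orthogonal_commute[of B A] add.commute[of B A] inner_commute)
    then show ?thesis
      using False by (simp add: max_norm_op_def BA del: blinfun_apply_blinfun_compose)
  qed
qed

text \<open>Taking real parts turns self-adjointness and positivity for \<open>cinner\<close> into
  those for \<open>inner\<close>. As norms and limits are the same for both scalar fields, the
  complex case reduces to the real one.\<close>

lemma complex_positive_op_imp_positive_op: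
  "complex_positive_op A \<Longrightarrow> positive_op A"
  unfolding complex_positive_op_def positive_op_def inner_eq_Re_cinner
  by (metis complex_nonneg_Reals_iff)

theorem theorem4p10:
  fixes A B :: "'a::{real_inner, complete_space} \<Rightarrow>\<^sub>L 'a"
    and C D :: "'b::{complex_inner, complete_space} \<Rightarrow>\<^sub>L 'b"
  shows
    "((\<exists>v::'a. v \<noteq> 0) \<and> separable_space (euclidean :: 'a topology) \<and>
        positive_op A \<and> positive_op B \<longrightarrow>
        (isosceles_orthogonal A B \<longleftrightarrow>
          (\<exists>x :: nat \<Rightarrow> 'a. (\<forall>n. norm (x n) = 1) \<and>
            (\<lambda>n. norm (blinfun_apply (max_norm_op A B) (x n))) \<longlonglongrightarrow> norm (A + B) \<and>
            (\<exists>L\<le>0. (\<lambda>n. inner (blinfun_apply (B o\<^sub>L A) (x n)) (x n)) \<longlonglongrightarrow> L)))) \<and>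
     ((\<exists>v::'b. v \<noteq> 0) \<and> separable_space (euclidean :: 'b topology) \<and>
        complex_positive_op C \<and> complex_positive_op D \<longrightarrow>
        (isosceles_orthogonal C D \<longleftrightarrow>
          (\<exists>x :: nat \<Rightarrow> 'b. (\<forall>n. norm (x n) = 1) \<and>
            (\<lambda>n. norm (blinfun_apply (max_norm_op C D) (x n))) \<longlonglongrightarrow> norm (C + D) \<and>
            (\<exists>L\<le>0. (\<lambda>n. Re (cinner (blinfun_apply (D o\<^sub>L C) (x n)) (x n))) \<longlonglongrightarrow> L))))"
proof (intro conjI impI; elim conjE exE)
  fix v :: 'a
  assume "v \<noteq> 0" "positive_op A" "positive_op B"
  then show "isosceles_orthogonal A B \<longleftrightarrow>
      (\<exists>x :: nat \<Rightarrow> 'a. (\<forall>n. norm (x n) = 1) \<and>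
        (\<lambda>n. norm (blinfun_apply (max_norm_op A B) (x n))) \<longlonglongrightarrow> norm (A + B) \<and>
        (\<exists>L\<le>0. (\<lambda>n. inner (blinfun_apply (B o\<^sub>L A) (x n)) (x n)) \<longlonglongrightarrow> L))"
    by (rule isosceles_orthogonal_positive_op_iff)
next
  fix v :: 'b
  assume "v \<noteq> 0" "complex_positive_op C" "complex_positive_op D"
  then show "isosceles_orthogonal C D \<longleftrightarrow>
      (\<exists>x :: nat \<Rightarrow> 'b. (\<forall>n. norm (x n) = 1) \<and>
        (\<lambda>n. norm (blinfun_apply (max_norm_op C D) (x n))) \<longlonglongrightarrow> norm (C + D) \<and>
        (\<exists>L\<le>0. (\<lambda>n. Re (cinner (blinfun_apply (D o\<^sub>L C) (x n)) (x n))) \<longlonglongrightarrow> L))"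
    \<comment> \<open>Read as a real inner product, the real part makes the claim an instance of the
      real equivalence.\<close>
    unfolding inner_eq_Re_cinner[symmetric]
    by (intro isosceles_orthogonal_positive_op_iff complex_positive_op_imp_positive_op)
qed

end
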